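(* Let $R$ be a ring, $\sigma$ an endomorphism of $R$, $\delta$ a $\sigma$-derivation of $R$, $M_R$ a completely $(\sigma,\delta)$-compatible right $R$-module and $N_R$ a submodule of $M_R$. Then for all $m\in M$ and $a,b\in R$ the following assertions hold: (1) If $ma\in N$, then $m\sigma^i(a)\in N$ and $m\delta^j(a)\in N$ for all $i,j\in\mathbb{N}$. (2) If $mab\in N$, then $m\sigma(\delta^j(a))\delta(b)\in N$ and $m\sigma^i(\delta(a))\delta^j(b)\in N$ for all $i,j\in\mathbb{N}$. In particular, $ma\delta^j(b)\in N$ and $m\delta^j(a)b\in N$ for all $j\in\mathbb{N}$. (3) If $mab\in N$ or $m\sigma(a)b\in N$, then $m\delta(a)b\in N$.
   Context: Rings are associative with identity, not necessarily commutative; modules are right modules; $\mathbb{N}$ includes $0$. A $\sigma$-derivation of $R$ is an additive map $\delta:R\to R$ with $\delta(rs)=\sigma(r)\delta(s)+\delta(r)s$ for all $r,s\in R$. A right module $L_R$ is $\sigma$-compatible if for all $m\in L$, $r\in R$: $mr=0$ if and only if $m\sigma(r)=0$; it is $\delta$-compatible if $mr=0$ implies $m\delta(r)=0$ for all $m\in L$, $r\in R$. $L_R$ is completely $\sigma$-compatible (resp. completely $\delta$-compatible) if $(L/N)_R$ is $\sigma$-compatible (resp. $\delta$-compatible) for every submodule $N_R$ of $L_R$; it is completely $(\sigma,\delta)$-compatible if it is both. *)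

theory Defs
  imports "HOL-Algebra.QuotRing" "HOL-Algebra.Module"
begin

text \<open>
  \<^locale>\<open>module\<close> of \<open>HOL-Algebra\<close> treats left modules over commutative rings only. As in
  that theory, the record of a module extends the ring record, but only its additive part is used;
  \<open>mult\<close> and \<open>one\<close> of a module are irrelevant.
\<close>

record ('a, 'b) rmodule = "'b ring" +
  rsmult :: "['b, 'a] \<Rightarrow> 'b" (infixl \<open>\<triangleleft>\<index>\<close> 70)

locale right_module = R?: ring R + M?: abelian_group M
  for R :: "('a, 'c) ring_scheme" (structure) and M :: "('a, 'b, 'd) rmodule_scheme" (structure) +
  assumes rsmult_closed [simp, intro]:
      "\<lbrakk>x \<in> carrier M; a \<in> carrier R\<rbrakk> \<Longrightarrow> x \<triangleleft>\<^bsub>M\<^esub> a \<in> carrier M"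
    and rsmult_l_distr:
      "\<lbrakk>x \<in> carrier M; y \<in> carrier M; a \<in> carrier R\<rbrakk> \<Longrightarrow>
        (x \<oplus>\<^bsub>M\<^esub> y) \<triangleleft>\<^bsub>M\<^esub> a = x \<triangleleft>\<^bsub>M\<^esub> a \<oplus>\<^bsub>M\<^esub> y \<triangleleft>\<^bsub>M\<^esub> a"
    and rsmult_r_distr:
      "\<lbrakk>x \<in> carrier M; a \<in> carrier R; b \<in> carrier R\<rbrakk> \<Longrightarrow>
        x \<triangleleft>\<^bsub>M\<^esub> (a \<oplus>\<^bsub>R\<^esub> b) = x \<triangleleft>\<^bsub>M\<^esub> a \<oplus>\<^bsub>M\<^esub> x \<triangleleft>\<^bsub>M\<^esub> b"
    and rsmult_assoc:
      "\<lbrakk>x \<in> carrier M; a \<in> carrier R; b \<in> carrier R\<rbrakk> \<Longrightarrow>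
        x \<triangleleft>\<^bsub>M\<^esub> (a \<otimes>\<^bsub>R\<^esub> b) = (x \<triangleleft>\<^bsub>M\<^esub> a) \<triangleleft>\<^bsub>M\<^esub> b"
    and rsmult_one [simp]:
      "x \<in> carrier M \<Longrightarrow> x \<triangleleft>\<^bsub>M\<^esub> \<one>\<^bsub>R\<^esub> = x"

locale right_submodule = additive_subgroup N M
  for N and R :: "('a, 'c) ring_scheme" and M :: "('a, 'b, 'd) rmodule_scheme" (structure) +
  assumes rsmult_mem: "\<lbrakk>x \<in> N; a \<in> carrier R\<rbrakk> \<Longrightarrow> x \<triangleleft>\<^bsub>M\<^esub> a \<in> N"

text \<open>
  The quotient \<open>M / N\<close> on the additive cosets of \<open>N\<close>. The action is a union over all
  representatives of a coset, as for \<^const>\<open>rcoset_mult\<close>; see \<open>rsmult_coset\<close> below.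
\<close>

definition quot_rmodule :: "('a, 'b, 'd) rmodule_scheme \<Rightarrow> 'b set \<Rightarrow> ('a, 'b set) rmodule" where
  "quot_rmodule M N =
    \<lparr>carrier = a_rcosets\<^bsub>M\<^esub> N, monoid.mult = undefined, one = undefined,
     zero = N, add = set_add M,
     rsmult = (\<lambda>C a. \<Union>x\<in>C. N +>\<^bsub>M\<^esub> (x \<triangleleft>\<^bsub>M\<^esub> a))\<rparr>"

definition skew_derivation :: "('a, 'c) ring_scheme \<Rightarrow> ('a \<Rightarrow> 'a) \<Rightarrow> ('a \<Rightarrow> 'a) \<Rightarrow> bool" where
  "skew_derivation R \<sigma> \<delta> \<longleftrightarrow>
     \<delta> \<in> carrier R \<rightarrow> carrier R \<and>
     (\<forall>r\<in>carrier R. \<forall>s\<in>carrier R. \<delta> (r \<oplus>\<^bsub>R\<^esub> s) = \<delta> r \<oplus>\<^bsub>R\<^esub> \<delta> s) \<and>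
     (\<forall>r\<in>carrier R. \<forall>s\<in>carrier R.
        \<delta> (r \<otimes>\<^bsub>R\<^esub> s) = \<sigma> r \<otimes>\<^bsub>R\<^esub> \<delta> s \<oplus>\<^bsub>R\<^esub> \<delta> r \<otimes>\<^bsub>R\<^esub> s)"

definition sigma_compatible ::
  "('a, 'c) ring_scheme \<Rightarrow> ('a \<Rightarrow> 'a) \<Rightarrow> ('a, 'b, 'd) rmodule_scheme \<Rightarrow> bool" where
  "sigma_compatible R \<sigma> L \<longleftrightarrow>
     (\<forall>m\<in>carrier L. \<forall>r\<in>carrier R. m \<triangleleft>\<^bsub>L\<^esub> r = \<zero>\<^bsub>L\<^esub> \<longleftrightarrow> m \<triangleleft>\<^bsub>L\<^esub> \<sigma> r = \<zero>\<^bsub>L\<^esub>)"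

definition delta_compatible ::
  "('a, 'c) ring_scheme \<Rightarrow> ('a \<Rightarrow> 'a) \<Rightarrow> ('a, 'b, 'd) rmodule_scheme \<Rightarrow> bool" where
  "delta_compatible R \<delta> L \<longleftrightarrow>
     (\<forall>m\<in>carrier L. \<forall>r\<in>carrier R. m \<triangleleft>\<^bsub>L\<^esub> r = \<zero>\<^bsub>L\<^esub> \<longrightarrow> m \<triangleleft>\<^bsub>L\<^esub> \<delta> r = \<zero>\<^bsub>L\<^esub>)"

definition completely_sigma_compatible ::
  "('a, 'c) ring_scheme \<Rightarrow> ('a \<Rightarrow> 'a) \<Rightarrow> ('a, 'b, 'd) rmodule_scheme \<Rightarrow> bool" where
  "completely_sigma_compatible R \<sigma> L \<longleftrightarrow>
     (\<forall>N. right_submodule N R L \<longrightarrow> sigma_compatible R \<sigma> (quot_rmodule L N))"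

definition completely_delta_compatible ::
  "('a, 'c) ring_scheme \<Rightarrow> ('a \<Rightarrow> 'a) \<Rightarrow> ('a, 'b, 'd) rmodule_scheme \<Rightarrow> bool" where
  "completely_delta_compatible R \<delta> L \<longleftrightarrow>
     (\<forall>N. right_submodule N R L \<longrightarrow> delta_compatible R \<delta> (quot_rmodule L N))"

definition completely_compatible ::
  "('a, 'c) ring_scheme \<Rightarrow> ('a \<Rightarrow> 'a) \<Rightarrow> ('a \<Rightarrow> 'a) \<Rightarrow> ('a, 'b, 'd) rmodule_scheme \<Rightarrow> bool" where
  "completely_compatible R \<sigma> \<delta> L \<longleftrightarrow>
     completely_sigma_compatible R \<sigma> L \<and> completely_delta_compatible R \<delta> L"

context right_module
begin

lemma rsmult_coset:
  assumes N: "right_submodule N R M" and x: "x \<in> carrier M" and a: "a \<in> carrier R"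
  shows "(N +>\<^bsub>M\<^esub> x) \<triangleleft>\<^bsub>quot_rmodule M N\<^esub> a = N +>\<^bsub>M\<^esub> (x \<triangleleft>\<^bsub>M\<^esub> a)"
proof -
  interpret N: right_submodule N R M by (rule N)
  interpret A: abelian_subgroup N M
    by (rule abelian_subgroupI3) (unfold_locales)
  have eq: "N +>\<^bsub>M\<^esub> (y \<triangleleft>\<^bsub>M\<^esub> a) = N +>\<^bsub>M\<^esub> (x \<triangleleft>\<^bsub>M\<^esub> a)" if y: "y \<in> N +>\<^bsub>M\<^esub> x" for y
  proof -
    from y obtain n where n: "n \<in> N" "y = n \<oplus>\<^bsub>M\<^esub> x"
      by (auto simp: a_r_coset_def r_coset_def)
    have "y \<triangleleft>\<^bsub>M\<^esub> a = n \<triangleleft>\<^bsub>M\<^esub> a \<oplus>\<^bsub>M\<^esub> x \<triangleleft>\<^bsub>M\<^esub> a"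
      using n x a by (simp add: rsmult_l_distr)
    then have "y \<triangleleft>\<^bsub>M\<^esub> a \<in> N +>\<^bsub>M\<^esub> (x \<triangleleft>\<^bsub>M\<^esub> a)"
      using N.rsmult_mem[OF n(1) a] by (auto simp: a_r_coset_def r_coset_def)
    then show ?thesis
      using A.a_repr_independence'[OF _ rsmult_closed[OF x a]] by simp
  qed
  then have "(\<Union>y \<in> N +>\<^bsub>M\<^esub> x. N +>\<^bsub>M\<^esub> (y \<triangleleft>\<^bsub>M\<^esub> a)) = N +>\<^bsub>M\<^esub> (x \<triangleleft>\<^bsub>M\<^esub> a)"
    using A.a_rcos_self[OF x] by blast
  then show ?thesis by (simp only: quot_rmodule_def rmodule.simps)
qed

lemma right_module_quot:
  assumes N: "right_submodule N R M"
  shows "right_module R (quot_rmodule M N)"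
proof -
  interpret N: right_submodule N R M by (rule N)
  interpret A: abelian_subgroup N M
    by (rule abelian_subgroupI3) (unfold_locales)
  let ?Q = "quot_rmodule M N"
  have car: "C \<in> carrier ?Q \<longleftrightarrow> (\<exists>x\<in>carrier M. C = N +>\<^bsub>M\<^esub> x)" for C
    by (auto simp: quot_rmodule_def A_RCOSETS_def RCOSETS_def a_r_coset_def)
  have add: "(N +>\<^bsub>M\<^esub> x) \<oplus>\<^bsub>?Q\<^esub> (N +>\<^bsub>M\<^esub> y) = N +>\<^bsub>M\<^esub> (x \<oplus>\<^bsub>M\<^esub> y)"
    if "x \<in> carrier M" "y \<in> carrier M" for x y
    using A.a_rcos_sum[OF that] by (simp add: quot_rmodule_def)
  have zero: "\<zero>\<^bsub>?Q\<^esub> = N +>\<^bsub>M\<^esub> \<zero>\<^bsub>M\<^esub>"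
    using M.a_coset_add_zero[OF N.a_subset] by (simp add: quot_rmodule_def)
  have inv: "\<exists>y\<in>carrier M. N +>\<^bsub>M\<^esub> (y \<oplus>\<^bsub>M\<^esub> x) = N +>\<^bsub>M\<^esub> \<zero>\<^bsub>M\<^esub>" if "x \<in> carrier M" for x
    using that by (intro bexI[of _ "\<ominus>\<^bsub>M\<^esub> x"]) (simp_all add: M.l_neg)
  have Q: "abelian_group ?Q"
  proof (rule abelian_groupI)
    fix C assume "C \<in> carrier ?Q"
    then obtain x where x: "x \<in> carrier M" "C = N +>\<^bsub>M\<^esub> x" by (auto simp: car)
    obtain y where y: "y \<in> carrier M" "N +>\<^bsub>M\<^esub> (y \<oplus>\<^bsub>M\<^esub> x) = N +>\<^bsub>M\<^esub> \<zero>\<^bsub>M\<^esub>"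
      using inv[OF x(1)] by blast
    show "\<exists>D\<in>carrier ?Q. D \<oplus>\<^bsub>?Q\<^esub> C = \<zero>\<^bsub>?Q\<^esub>"
      using x y by (intro bexI[of _ "N +>\<^bsub>M\<^esub> y"]) (auto simp: car add zero)
  qed (auto simp: car add zero M.a_ac)
  show ?thesis
    by (intro right_module.intro right_module_axioms.intro Q R.ring_axioms)
       (auto simp: car add rsmult_coset[OF N] rsmult_l_distr rsmult_r_distr rsmult_assoc)
qed

end

end

theory Submission
  imports Defs
begin

text \<open>
  Everything reduces to one step: if \<open>mab \<in> N\<close> then \<open>m\<sigma>(a)b\<close> and \<open>m\<delta>(a)b\<close> lie in \<open>N\<close>. Indeed
  \<open>m\<sigma>(ab) = m\<sigma>(a)\<sigma>(b) \<in> N\<close>, and \<open>\<sigma>\<close>-compatibility of \<open>M / N\<close> at the element \<open>m\<sigma>(a)\<close> removes the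
  second \<open>\<sigma>\<close>. Then \<open>m\<sigma>(a)\<delta>(b) \<in> N\<close>, and subtracting it from
  \<open>m\<delta>(ab) = m\<sigma>(a)\<delta>(b) + m\<delta>(a)b \<in> N\<close> leaves \<open>m\<delta>(a)b\<close>.
\<close>

context right_module
begin

text \<open>The zero of \<open>quot_rmodule M N\<close> is \<open>N\<close> itself, and a coset
  equals \<open>N\<close> exactly when its representative lies in \<open>N\<close>. This translates
  annihilation in the quotient into membership in \<open>N\<close>.\<close>

lemma quot_rmodule_rsmult_eq_zero_iff:
  assumes N: "right_submodule N R M" and x: "x \<in> carrier M" and a: "a \<in> carrier R"
  shows "(N +>\<^bsub>M\<^esub> x) \<triangleleft>\<^bsub>quot_rmodule M N\<^esub> a = \<zero>\<^bsub>quot_rmodule M N\<^esub> \<longleftrightarrow> x \<triangleleft>\<^bsub>M\<^esub> a \<in> N"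
proof -
  interpret N: right_submodule N R M by (rule N)
  interpret A: abelian_subgroup N M
    by (rule abelian_subgroupI3) (unfold_locales)
  have "N +>\<^bsub>M\<^esub> (x \<triangleleft>\<^bsub>M\<^esub> a) = N \<longleftrightarrow> x \<triangleleft>\<^bsub>M\<^esub> a \<in> N"
    using A.a_rcos_self[OF rsmult_closed[OF x a]] A.a_rcos_const by auto
  \<comment> \<open>Two passes: the action has to be evaluated on cosets before
    \<open>quot_rmodule_def\<close> is unfolded, which would turn it into a union.\<close>
  then show ?thesis
    by (simp add: rsmult_coset[OF N x a]) (simp add: quot_rmodule_def)
qed

lemma coset_in_carrier_quot_rmodule:
  "x \<in> carrier M \<Longrightarrow> N +>\<^bsub>M\<^esub> x \<in> carrier (quot_rmodule M N)"
  by (auto simp: quot_rmodule_def A_RCOSETS_def RCOSETS_def a_r_coset_def)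

text \<open>Testing compatibility at the coset of \<open>x\<close> removes cosets from the rest of
  the argument.\<close>

lemma sigma_compatible_quot_rmoduleD:
  assumes "right_submodule N R M" "sigma_compatible R \<sigma> (quot_rmodule M N)"
    and "\<sigma> \<in> carrier R \<rightarrow> carrier R" "x \<in> carrier M" "a \<in> carrier R"
  shows "x \<triangleleft>\<^bsub>M\<^esub> \<sigma> a \<in> N \<longleftrightarrow> x \<triangleleft>\<^bsub>M\<^esub> a \<in> N"
  using assms coset_in_carrier_quot_rmodule[of x N]
  by (auto simp: sigma_compatible_def quot_rmodule_rsmult_eq_zero_iff Pi_iff)

lemma delta_compatible_quot_rmoduleD:
  assumes "right_submodule N R M" "delta_compatible R \<delta> (quot_rmodule M N)"
    and "\<delta> \<in> carrier R \<rightarrow> carrier R" "x \<in> carrier M" "a \<in> carrier R" "x \<triangleleft>\<^bsub>M\<^esub> a \<in> N"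
  shows "x \<triangleleft>\<^bsub>M\<^esub> \<delta> a \<in> N"
  using assms coset_in_carrier_quot_rmodule[of x N]
  by (auto simp: delta_compatible_def quot_rmodule_rsmult_eq_zero_iff Pi_iff)

end

theorem proposition3p3:
  fixes R :: "('a, 'c) ring_scheme" and M :: "('a, 'b, 'd) rmodule_scheme"
    and \<sigma> \<delta> :: "'a \<Rightarrow> 'a" and N :: "'b set" and m :: 'b and a b :: 'a
  assumes "ring R"
    and "\<sigma> \<in> ring_hom R R"
    and "skew_derivation R \<sigma> \<delta>"
    and "right_module R M"
    and "completely_compatible R \<sigma> \<delta> M"
    and "right_submodule N R M"
    and "m \<in> carrier M" and "a \<in> carrier R" and "b \<in> carrier R"
  shows "(m \<triangleleft>\<^bsub>M\<^esub> a \<in> N \<longrightarrow>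
            (\<forall>i j. m \<triangleleft>\<^bsub>M\<^esub> (\<sigma> ^^ i) a \<in> N \<and> m \<triangleleft>\<^bsub>M\<^esub> (\<delta> ^^ j) a \<in> N))
       \<and> (m \<triangleleft>\<^bsub>M\<^esub> a \<triangleleft>\<^bsub>M\<^esub> b \<in> N \<longrightarrow>
            (\<forall>i j. m \<triangleleft>\<^bsub>M\<^esub> \<sigma> ((\<delta> ^^ j) a) \<triangleleft>\<^bsub>M\<^esub> \<delta> b \<in> N
                 \<and> m \<triangleleft>\<^bsub>M\<^esub> (\<sigma> ^^ i) (\<delta> a) \<triangleleft>\<^bsub>M\<^esub> (\<delta> ^^ j) b \<in> N)
          \<and> (\<forall>j. m \<triangleleft>\<^bsub>M\<^esub> a \<triangleleft>\<^bsub>M\<^esub> (\<delta> ^^ j) b \<in> N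
               \<and> m \<triangleleft>\<^bsub>M\<^esub> (\<delta> ^^ j) a \<triangleleft>\<^bsub>M\<^esub> b \<in> N))
       \<and> (m \<triangleleft>\<^bsub>M\<^esub> a \<triangleleft>\<^bsub>M\<^esub> b \<in> N \<or> m \<triangleleft>\<^bsub>M\<^esub> \<sigma> a \<triangleleft>\<^bsub>M\<^esub> b \<in> N \<longrightarrow>
            m \<triangleleft>\<^bsub>M\<^esub> \<delta> a \<triangleleft>\<^bsub>M\<^esub> b \<in> N)"
proof -
  interpret right_module R M by fact
  interpret N: right_submodule N R M by fact
  have \<sigma>: "\<sigma> \<in> carrier R \<rightarrow> carrier R" and \<delta>: "\<delta> \<in> carrier R \<rightarrow> carrier R"
    using assms(2,3) by (auto simp: ring_hom_def skew_derivation_def)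
  have pow: "(f ^^ n) r \<in> carrier R" if "f \<in> carrier R \<rightarrow> carrier R" "r \<in> carrier R" for f n r
    using that by (induction n) auto
  have cl [simp]: "\<sigma> r \<in> carrier R" "\<delta> r \<in> carrier R"
    "(\<sigma> ^^ n) r \<in> carrier R" "(\<delta> ^^ n) r \<in> carrier R" if "r \<in> carrier R" for r n
    using that \<sigma> \<delta> by (auto intro: pow)
  have compat: "sigma_compatible R \<sigma> (quot_rmodule M N)" "delta_compatible R \<delta> (quot_rmodule M N)"
    using assms(5,6)
    by (auto simp: completely_compatible_def completely_sigma_compatible_def
        completely_delta_compatible_def)
  note S = sigma_compatible_quot_rmoduleD[OF assms(6) compat(1) \<sigma>]
  note D = delta_compatible_quot_rmoduleD[OF assms(6) compat(2) \<delta>]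
  \<comment> \<open>Here and in \<open>Dj\<close> the element \<open>x\<close> is arbitrary, so it
    may be a product such as \<open>m \<triangleleft> a\<close>; thus these facts govern the last
    factor of a product. The factor before it is handled from \<open>S1\<close> on.\<close>
  have Si: "x \<triangleleft>\<^bsub>M\<^esub> (\<sigma> ^^ i) r \<in> N \<longleftrightarrow> x \<triangleleft>\<^bsub>M\<^esub> r \<in> N"
    if "x \<in> carrier M" "r \<in> carrier R" for x r i
    using that by (induction i) (simp_all add: S)
  have Dj: "x \<triangleleft>\<^bsub>M\<^esub> (\<delta> ^^ j) r \<in> N"
    if "x \<in> carrier M" "r \<in> carrier R" "x \<triangleleft>\<^bsub>M\<^esub> r \<in> N" for x r j
    using that by (induction j) (simp_all add: D)
  \<comment> \<open>An equivalence is proved because the last assertion may also start from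
    \<open>m \<triangleleft> \<sigma> a \<triangleleft> b\<close> in \<open>N\<close>.\<close>
  have S1: "x \<triangleleft>\<^bsub>M\<^esub> \<sigma> r \<triangleleft>\<^bsub>M\<^esub> s \<in> N \<longleftrightarrow> x \<triangleleft>\<^bsub>M\<^esub> r \<triangleleft>\<^bsub>M\<^esub> s \<in> N"
    if [simp]: "x \<in> carrier M" "r \<in> carrier R" "s \<in> carrier R" for x r s
  proof -
    have "x \<triangleleft>\<^bsub>M\<^esub> \<sigma> r \<triangleleft>\<^bsub>M\<^esub> s \<in> N \<longleftrightarrow> x \<triangleleft>\<^bsub>M\<^esub> \<sigma> (r \<otimes>\<^bsub>R\<^esub> s) \<in> N"
      using S[of "x \<triangleleft>\<^bsub>M\<^esub> \<sigma> r" s] by (simp add: ring_hom_mult[OF assms(2)] rsmult_assoc)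
    also have "\<dots> \<longleftrightarrow> x \<triangleleft>\<^bsub>M\<^esub> r \<triangleleft>\<^bsub>M\<^esub> s \<in> N"
      by (simp add: S rsmult_assoc)
    finally show ?thesis .
  qed
  have D1: "x \<triangleleft>\<^bsub>M\<^esub> \<delta> r \<triangleleft>\<^bsub>M\<^esub> s \<in> N"
    if [simp]: "x \<in> carrier M" "r \<in> carrier R" "s \<in> carrier R" and N: "x \<triangleleft>\<^bsub>M\<^esub> r \<triangleleft>\<^bsub>M\<^esub> s \<in> N" for x r s
  proof -
    let ?u = "x \<triangleleft>\<^bsub>M\<^esub> \<sigma> r \<triangleleft>\<^bsub>M\<^esub> \<delta> s" and ?v = "x \<triangleleft>\<^bsub>M\<^esub> \<delta> r \<triangleleft>\<^bsub>M\<^esub> s"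
    \<comment> \<open>\<open>S1\<close> exchanges \<open>\<sigma> r\<close> for \<open>r\<close>,
      and \<open>D\<close> passes from \<open>s\<close> to \<open>\<delta> s\<close>.\<close>
    have u: "?u \<in> N"
      using N by (simp add: D S1)
    have "\<delta> (r \<otimes>\<^bsub>R\<^esub> s) = \<sigma> r \<otimes>\<^bsub>R\<^esub> \<delta> s \<oplus>\<^bsub>R\<^esub> \<delta> r \<otimes>\<^bsub>R\<^esub> s"
      using assms(3) by (simp add: skew_derivation_def)
    then have "x \<triangleleft>\<^bsub>M\<^esub> \<delta> (r \<otimes>\<^bsub>R\<^esub> s) = ?u \<oplus>\<^bsub>M\<^esub> ?v"
      by (simp add: rsmult_r_distr rsmult_assoc)
    moreover have "x \<triangleleft>\<^bsub>M\<^esub> \<delta> (r \<otimes>\<^bsub>R\<^esub> s) \<in> N"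
      using N by (simp add: D rsmult_assoc)
    \<comment> \<open>Cancelling \<open>?u\<close> from the left, in the shape that
      \<open>M.r_neg1\<close> collapses to \<open>?v\<close>.\<close>
    ultimately have "\<ominus>\<^bsub>M\<^esub> ?u \<oplus>\<^bsub>M\<^esub> (?u \<oplus>\<^bsub>M\<^esub> ?v) \<in> N"
      using u by (simp add: N.a_inv_closed)
    then show ?thesis
      by (simp add: M.r_neg1)
  qed
  \<comment> \<open>\<open>D1\<close> returns its own premise with \<open>\<delta> r\<close> for
    \<open>r\<close>, so it iterates with \<open>x\<close> and \<open>s\<close> fixed.\<close>
  have Dj1: "x \<triangleleft>\<^bsub>M\<^esub> (\<delta> ^^ j) r \<triangleleft>\<^bsub>M\<^esub> s \<in> N"
    if "x \<in> carrier M" "r \<in> carrier R" "s \<in> carrier R" "x \<triangleleft>\<^bsub>M\<^esub> r \<triangleleft>\<^bsub>M\<^esub> s \<in> N" for x r s j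
    using that by (induction j) (simp_all add: D1)
  have Si1: "x \<triangleleft>\<^bsub>M\<^esub> (\<sigma> ^^ i) r \<triangleleft>\<^bsub>M\<^esub> s \<in> N \<longleftrightarrow> x \<triangleleft>\<^bsub>M\<^esub> r \<triangleleft>\<^bsub>M\<^esub> s \<in> N"
    if "x \<in> carrier M" "r \<in> carrier R" "s \<in> carrier R" for x r s i
    using that by (induction i) (simp_all add: S1)
  \<comment> \<open>Powers of \<sigma> are stripped by \<open>S1\<close> and \<open>Si1\<close>;
    then \<open>D\<close> and \<open>Dj\<close> account for \<delta> on the last factor,
    \<open>D1\<close> and \<open>Dj1\<close> for \<delta> on the one before. The alternative
    hypothesis with \<open>\<sigma> a\<close> becomes the one with \<open>a\<close> by
    \<open>S1\<close>.\<close>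
  show ?thesis
    using assms(7-9) by (auto simp: Si Dj S1 Si1 D D1 Dj1)
qed

end
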